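(* Let $T\in\mathbb{C}^{n\times n}$ be a Toeplitz matrix, and let $p \in \mathcal{P}_{s_p}$, $q \in \mathcal{P}_{s_q}$ be polynomials such that $q(T)$ is invertible. Let $(G_p,B_p)$ and $(G_q,B_q)$ be generators of $p(T)$ and $q(T)$, respectively. Then $r(T) = q(T)^{-1}p(T)$ has displacement rank at most $2\max\{s_p,s_q\}+1$, and a generator $(G,B)$ for $r(T)$ is given by \[ G = \begin{bmatrix} -(Z-I)\,q(T)^{-1}(Z-I)^{-1}G_q & (Z-I)\,q(T)^{-1}(Z-I)^{-1}G_p & e_1\end{bmatrix}, \] \[ B = \begin{bmatrix} (Z-I)\,p(T)^*q(T)^{-*}(Z-I)^{-1}B_q & B_p & (Z-I)\,p(T)^*q(T)^{-*}(Z-I)^{-1}e_1\end{bmatrix}. \]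
   Context: $Z\in\mathbb{C}^{n\times n}$ denotes the downward shift matrix (ones on the first subdiagonal, zeros elsewhere), $I$ the identity, $e_1$ the first unit vector, $M^*$ the conjugate transpose and $M^{-*}=(M^{-1})^*$. For $A\in\mathbb{C}^{n\times n}$ the displacement is $\nabla(A)=A-ZAZ^*$, and the displacement rank of $A$ is $\operatorname{rank}\nabla(A)$. A generator for $A$ is a pair $(G,B)$ of matrices with $n$ rows and the same number of columns (not necessarily equal to the displacement rank) such that $\nabla(A)=GB^*$. $\mathcal{P}_s$ denotes the set of polynomials of degree at most $s$. A Toeplitz matrix is one that is constant along each diagonal. *)

theory Defs
  imports
    "Jordan_Normal_Form.Schur_Decomposition"
    "Jordan_Normal_Form.Gauss_Jordan_Elimination"
    "Jordan_Normal_Form.DL_Rank"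
begin

definition shift_mat :: "nat \<Rightarrow> complex mat" where
  "shift_mat n = mat n n (\<lambda>(i, j). if i = Suc j then 1 else 0)"

definition displacement :: "complex mat \<Rightarrow> complex mat" where
  "displacement A =
     A - shift_mat (dim_row A) * A * mat_adjoint (shift_mat (dim_row A))"

definition displacement_rank :: "complex mat \<Rightarrow> nat" where
  "displacement_rank A = vec_space.rank (dim_row A) (displacement A)"

text \<open>The common number of columns \<open>k\<close> of a generator is arbitrary; it need not be
  the displacement rank.\<close>

definition is_generator :: "complex mat \<Rightarrow> complex mat \<Rightarrow> complex mat \<Rightarrow> bool" where
  "is_generator A G B \<longleftrightarrow>
     (\<exists>k. G \<in> carrier_mat (dim_row A) k \<and> B \<in> carrier_mat (dim_row A) k \<and>
          displacement A = G * mat_adjoint B)"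

text \<open>Two positions lie on the same diagonal iff \<open>i - j = i' - j'\<close> as integers; this is
  written additively to avoid truncated subtraction.\<close>

definition toeplitz :: "complex mat \<Rightarrow> bool" where
  "toeplitz A \<longleftrightarrow>
     (\<forall>i < dim_row A. \<forall>j < dim_col A. \<forall>i' < dim_row A. \<forall>j' < dim_col A.
        i + j' = i' + j \<longrightarrow> A $$ (i, j) = A $$ (i', j'))"

text \<open>\<open>p(A)\<close> is the sum of \<open>coeff p k\<close> times \<open>A ^\<^sub>m k\<close>. It is written entrywise, because
  matrices of varying dimension do not form a \<open>comm_monoid_add\<close> for \<open>sum\<close>.\<close>

definition poly_mat :: "complex poly \<Rightarrow> complex mat \<Rightarrow> complex mat" where
  "poly_mat p A = mat (dim_row A) (dim_row A)
     (\<lambda>(i, j). \<Sum>k\<le>degree p. coeff p k * (A ^\<^sub>m k) $$ (i, j))"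

text \<open>Meaningful only for invertible matrices, for which \<open>mat_inverse\<close> is not \<open>None\<close>.\<close>

definition mat_inv :: "complex mat \<Rightarrow> complex mat" where
  "mat_inv A = the (mat_inverse A)"

end

theory Submission
  imports Defs
begin

text \<open>Write \<open>P = p(T)\<close>, \<open>Q = q(T)\<close>, \<open>r = Q\<^sup>-\<^sup>1 P\<close> and \<open>[A, Z] = A Z - Z A\<close>. Both claims rest on the identity
  \<open>Z Z\<^sup>* = I - e\<^sub>1 e\<^sub>1\<^sup>*\<close>, but the rank bound is not read off from the generator, whose
  number of columns depends on the given generators of \<open>P\<close> and \<open>Q\<close>.

  For the rank, the identity gives \<open>\<nabla>(r) = r e\<^sub>1 e\<^sub>1\<^sup>* + [r, Z] Z\<^sup>*\<close>, so it suffices that \<open>[r, Z]\<close> has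
  rank at most \<open>2 s\<close> with \<open>s = max s\<^sub>p s\<^sub>q\<close>. Since \<open>[_, Z]\<close> is a derivation,
  \<open>[r, Z] = Q\<^sup>-\<^sup>1 ([P, Z] - [Q, Z] r)\<close> (\<open>commutator_quotient\<close>). For a Toeplitz matrix \<open>[T, Z]\<close> lives in one
  row and one column and has rank at most \<open>2\<close> (\<open>toeplitz_commutator_shift\<close>). Evaluating \<open>p\<close> and \<open>q\<close>
  simultaneously by Horner's rule, every step multiplies the bracket from the left by \<open>T\<close> and adds a
  matrix \<open>[T, Z] X\<close> of rank at most \<open>2\<close>; after \<open>s\<close> steps the rank is at most \<open>2 s\<close>
  (\<open>commutator_poly_pair\<close>).

  For the generator, \<open>G B\<^sup>*\<close> is a sum of three products, in which the given generators combine to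
  \<open>\<nabla>(Q)\<close> and \<open>\<nabla>(P)\<close>. The sum equals \<open>\<nabla>(r)\<close> by an identity valid for all square matrices \<open>P\<close> and all invertible
  \<open>Q\<close> (\<open>displacement_quotient\<close>).\<close>

section \<open>Adjoints, inverses and the shift\<close>

lemma mat_adjoint_dim [simp]:
  "dim_row (mat_adjoint A) = dim_col A" "dim_col (mat_adjoint A) = dim_row A"
  by (simp_all add: mat_adjoint_def)

lemma mat_adjoint_index:
  "i < dim_col A \<Longrightarrow> j < dim_row A \<Longrightarrow> mat_adjoint A $$ (i, j) = conjugate (A $$ (j, i))"
  by (simp add: mat_adjoint_def mat_of_rows_def)

lemma mat_adjoint_carrier [simp]: "A \<in> carrier_mat n m \<Longrightarrow> mat_adjoint A \<in> carrier_mat m n"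
  by auto

lemma mat_adjoint_mult:
  assumes "A \<in> carrier_mat n k" "B \<in> carrier_mat k m"
  shows "mat_adjoint (A * B) = mat_adjoint B * mat_adjoint (A :: complex mat)"
  using assms
  by (intro eq_matI) (auto simp: mat_adjoint_index scalar_prod_def mult.commute intro!: sum.cong)

lemma mat_adjoint_adjoint [simp]: "mat_adjoint (mat_adjoint A) = (A :: complex mat)"
  by (intro eq_matI) (simp_all add: mat_adjoint_index)

lemma mat_adjoint_minus:
  assumes "A \<in> carrier_mat n m" "B \<in> carrier_mat n m"
  shows "mat_adjoint (A - B) = mat_adjoint A - mat_adjoint (B :: complex mat)"
  using assms by (intro eq_matI) (auto simp: mat_adjoint_index)

lemma mat_adjoint_one [simp]: "mat_adjoint (1\<^sub>m n) = (1\<^sub>m n :: complex mat)"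
  by (intro eq_matI) (auto simp: mat_adjoint_index)

lemma shift_mat_carrier [simp]: "shift_mat n \<in> carrier_mat n n"
  by (simp add: shift_mat_def)

lemma shift_mat_index: "i < n \<Longrightarrow> j < n \<Longrightarrow> shift_mat n $$ (i, j) = (if i = Suc j then 1 else 0)"
  by (simp add: shift_mat_def)

lemma shift_mat_mult_left:
  assumes "A \<in> carrier_mat n m" "i < n" "j < m"
  shows "(shift_mat n * A) $$ (i, j) = (if i = 0 then 0 else A $$ (i - 1, j))"
proof -
  have "(shift_mat n * A) $$ (i, j) = (\<Sum>l<n. (if i = Suc l then 1 else 0) * A $$ (l, j))"
    using assms by (simp add: scalar_prod_def shift_mat_def atLeast0LessThan)
  also have "\<dots> = (\<Sum>l<n. if l = i - 1 then (if i = 0 then 0 else A $$ (i - 1, j)) else 0)"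
    by (intro sum.cong) auto
  finally show ?thesis using assms by simp
qed

lemma shift_mat_mult_right:
  assumes "A \<in> carrier_mat m n" "i < m" "j < n"
  shows "(A * shift_mat n) $$ (i, j) = (if Suc j < n then A $$ (i, Suc j) else 0)"
proof -
  have "(A * shift_mat n) $$ (i, j) = (\<Sum>l<n. A $$ (i, l) * (if l = Suc j then 1 else 0))"
    using assms by (simp add: scalar_prod_def shift_mat_def atLeast0LessThan)
  also have "\<dots> = (\<Sum>l<n. if l = Suc j then A $$ (i, Suc j) else 0)"
    by (intro sum.cong) auto
  finally show ?thesis by simp
qed

text \<open>The matrix \<open>e\<^sub>1 e\<^sub>1\<^sup>*\<close>, as one square matrix: products of square matrices
  can be reassociated without an \<open>n \<times> 1\<close> factor in between.\<close>

definition unit_projector :: "nat \<Rightarrow> complex mat" where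
  "unit_projector n = mat n n (\<lambda>(i, j). if i = 0 \<and> j = 0 then 1 else 0)"

text \<open>The shift is a partial isometry onto the orthogonal complement of \<open>e\<^sub>1\<close>. This defect is the sole source of
  the extra generator column and of the \<open>+ 1\<close> in the rank bound.\<close>

lemma shift_mat_adjoint: "shift_mat n * mat_adjoint (shift_mat n) = 1\<^sub>m n - unit_projector n"
proof (rule eq_matI, goal_cases)
  case (1 i j)
  then have ij: "i < n" "j < n" by (simp_all add: unit_projector_def)
  have "(shift_mat n * mat_adjoint (shift_mat n)) $$ (i, j) =
      (if i = 0 then 0 else conjugate (shift_mat n $$ (j, i - 1)))"
    using ij by (subst shift_mat_mult_left[of _ n n]) (simp_all add: mat_adjoint_index shift_mat_def)
  also have "\<dots> = (1\<^sub>m n - unit_projector n) $$ (i, j)"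
    using ij by (auto simp: shift_mat_def unit_projector_def)
  finally show ?case .
qed (simp_all add: unit_projector_def shift_mat_def)

text \<open>In right-associated products of matrices an adjacent inverse pair has this shape, so that
  instances of the lemma serve as cancellation rules for the simplifier.\<close>

lemma mult_inverse_cancel:
  fixes A :: "'a :: semiring_1 mat"
  assumes "A \<in> carrier_mat n n" "B \<in> carrier_mat n n" "X \<in> carrier_mat n m" "A * B = 1\<^sub>m n"
  shows "A * (B * X) = X"
proof -
  have "A * (B * X) = A * B * X"
    by (rule assoc_mult_mat[OF assms(1-3), symmetric])
  then show ?thesis by (simp only: assms(4) left_mult_one_mat[OF assms(3)])
qed

lemma mat_inv_inverse:
  assumes A: "A \<in> carrier_mat n n" and unit: "A \<in> Units (ring_mat TYPE(complex) n ())"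
  shows "mat_inv A \<in> carrier_mat n n" "mat_inv A * A = 1\<^sub>m n" "A * mat_inv A = 1\<^sub>m n"
proof -
  obtain B where "mat_inverse A = Some B"
    using mat_inverse(1)[OF A, where b = "()"] unit by (cases "mat_inverse A") auto
  then show "mat_inv A \<in> carrier_mat n n" "mat_inv A * A = 1\<^sub>m n" "A * mat_inv A = 1\<^sub>m n"
    using mat_inverse(2)[OF A] by (simp_all add: mat_inv_def)
qed

lemma invertible_mat_Units:
  assumes A: "A \<in> carrier_mat n n" and "invertible_mat A"
  shows "A \<in> Units (ring_mat TYPE(complex) n ())"
proof -
  obtain B where B: "A * B = 1\<^sub>m n" "B * A = 1\<^sub>m (dim_row B)"
    using assms by (auto simp: invertible_mat_def inverts_mat_def)
  have "dim_col (A * B) = n" "dim_col (B * A) = dim_row B"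
    using B by simp_all
  then have "B \<in> carrier_mat n n" using A by auto
  with A B show ?thesis by (auto simp: Units_def ring_mat_def)
qed

text \<open>\<open>Z - I\<close> is lower triangular with all diagonal entries \<open>-1\<close>.\<close>

lemma shift_minus_one_Units:
  "shift_mat n - 1\<^sub>m n \<in> Units (ring_mat TYPE(complex) n ())"
proof (rule det_non_zero_imp_unit)
  let ?D = "shift_mat n - 1\<^sub>m n"
  have carrier: "?D \<in> carrier_mat n n" by (simp add: minus_carrier_mat[of _ n n])
  have "det ?D = prod_list (diag_mat ?D)"
    by (rule det_lower_triangular[OF _ carrier]) (simp add: shift_mat_index)
  also have "\<dots> = (\<Prod>i = 0..<n. -1)"
    unfolding prod_list_diag_prod using carrier by (intro prod.cong) (auto simp: shift_mat_index)
  finally show "det ?D \<noteq> 0" by simp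
  show "?D \<in> carrier_mat n n" by (rule carrier)
qed

section \<open>Sums of outer products\<close>

text \<open>This says that \<open>A\<close> is a sum of \<open>k\<close> outer products, which over a field means rank at most \<open>k\<close>.
  In this form the bound visibly survives addition and multiplication from either side, which are
  the only operations the rank argument performs.\<close>

definition outer_sum :: "nat \<Rightarrow> 'a :: comm_ring_1 mat \<Rightarrow> bool" where
  "outer_sum k A \<longleftrightarrow> (\<exists>f g. \<forall>i<dim_row A. \<forall>j<dim_col A. A $$ (i, j) = (\<Sum>t<k. f t i * g t j))"

lemma outer_sum_rank_le:
  fixes A :: "'a :: field mat"
  assumes "A \<in> carrier_mat n m" and "outer_sum k A"
  shows "vec_space.rank n A \<le> k"
proof -
  interpret vec_space "TYPE('a)" n .
  obtain f g where A: "\<And>i j. i < n \<Longrightarrow> j < m \<Longrightarrow> A $$ (i, j) = (\<Sum>t<k. f t i * g t j)"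
    using assms unfolding outer_sum_def by auto
  have "rank (mat n m (\<lambda>(i, j). \<Sum>t<k. f t i * g t j)) \<le> k"
  proof (induction k)
    case 0
    have "mat n m (\<lambda>(i, j). \<Sum>t<0. f t i * g t j) = 0\<^sub>m n m" by (intro eq_matI) simp_all
    then show ?case by (simp only: rank_0I)
  next
    case (Suc k)
    let ?S = "mat n m (\<lambda>(i, j). \<Sum>t<k. f t i * g t j)" and ?E = "mat n m (\<lambda>(i, j). f k i * g k j)"
    have "rank ?E \<le> 1"
      by (rule rank_le_1_product_entries[of _ m "f k" "g k"]) auto
    moreover have "rank (?S + ?E) \<le> rank ?S + rank ?E"
      by (rule rank_subadditive[of _ m]) auto
    moreover have "mat n m (\<lambda>(i, j). \<Sum>t<Suc k. f t i * g t j) = ?S + ?E" by auto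
    ultimately show ?case using Suc.IH by simp
  qed
  moreover have "A = mat n m (\<lambda>(i, j). \<Sum>t<k. f t i * g t j)"
    using assms(1) A by (intro eq_matI) auto
  ultimately show ?thesis by simp
qed

lemma sum_lessThan_add:
  fixes h :: "nat \<Rightarrow> 'a :: comm_monoid_add"
  shows "(\<Sum>t<k + l. h t) = (\<Sum>t<k. h t) + (\<Sum>t<l. h (k + t))"
  by (induction l) (auto simp: add.assoc)

lemma outer_sum_add:
  assumes "A \<in> carrier_mat n m" "B \<in> carrier_mat n m" "outer_sum k A" "outer_sum l B"
  shows "outer_sum (k + l) (A + B)"
proof -
  obtain f g where A: "\<And>i j. i < n \<Longrightarrow> j < m \<Longrightarrow> A $$ (i, j) = (\<Sum>t<k. f t i * g t j)"
    using assms unfolding outer_sum_def by auto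
  obtain f' g' where B: "\<And>i j. i < n \<Longrightarrow> j < m \<Longrightarrow> B $$ (i, j) = (\<Sum>t<l. f' t i * g' t j)"
    using assms unfolding outer_sum_def by auto
  let ?F = "\<lambda>t. if t < k then f t else f' (t - k)" and ?G = "\<lambda>t. if t < k then g t else g' (t - k)"
  have "(A + B) $$ (i, j) = (\<Sum>t<k + l. ?F t i * ?G t j)" if "i < n" "j < m" for i j
    using that assms(1,2) by (simp add: sum_lessThan_add A B)
  then show ?thesis
    unfolding outer_sum_def using assms(1,2) by (intro exI[of _ ?F] exI[of _ ?G]) auto
qed

lemma outer_sum_mult_left:
  assumes "X \<in> carrier_mat r n" "A \<in> carrier_mat n m" "outer_sum k A"
  shows "outer_sum k (X * A)"
proof -
  obtain f g where A: "\<And>i j. i < n \<Longrightarrow> j < m \<Longrightarrow> A $$ (i, j) = (\<Sum>t<k. f t i * g t j)"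
    using assms unfolding outer_sum_def by auto
  let ?F = "\<lambda>t i. \<Sum>l<n. X $$ (i, l) * f t l"
  have "(X * A) $$ (i, j) = (\<Sum>t<k. ?F t i * g t j)" if "i < r" "j < m" for i j
  proof -
    have "(X * A) $$ (i, j) = (\<Sum>l<n. X $$ (i, l) * (\<Sum>t<k. f t l * g t j))"
      using that assms(1,2) by (simp add: scalar_prod_def A atLeast0LessThan)
    also have "\<dots> = (\<Sum>t<k. ?F t i * g t j)"
      by (simp add: sum_distrib_left sum_distrib_right mult.assoc) (rule sum.swap)
    finally show ?thesis .
  qed
  then show ?thesis
    unfolding outer_sum_def using assms(1,2) by (intro exI[of _ ?F] exI[of _ g]) auto
qed

lemma outer_sum_mult_right:
  assumes "A \<in> carrier_mat n m" "X \<in> carrier_mat m r" "outer_sum k A"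
  shows "outer_sum k (A * X)"
proof -
  obtain f g where A: "\<And>i j. i < n \<Longrightarrow> j < m \<Longrightarrow> A $$ (i, j) = (\<Sum>t<k. f t i * g t j)"
    using assms unfolding outer_sum_def by auto
  let ?G = "\<lambda>t j. \<Sum>l<m. g t l * X $$ (l, j)"
  have "(A * X) $$ (i, j) = (\<Sum>t<k. f t i * ?G t j)" if "i < n" "j < r" for i j
  proof -
    have "(A * X) $$ (i, j) = (\<Sum>l<m. (\<Sum>t<k. f t i * g t l) * X $$ (l, j))"
      using that assms(1,2) by (simp add: scalar_prod_def A atLeast0LessThan)
    also have "\<dots> = (\<Sum>t<k. f t i * ?G t j)"
      by (simp add: sum_distrib_left sum_distrib_right mult.assoc) (rule sum.swap)
    finally show ?thesis .
  qed
  then show ?thesis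
    unfolding outer_sum_def using assms(1,2) by (intro exI[of _ f] exI[of _ ?G]) auto
qed

section \<open>Commutators with the shift\<close>

definition commutator :: "'a :: ring mat \<Rightarrow> 'a mat \<Rightarrow> 'a mat" where
  "commutator A B = A * B - B * A"

lemma commutator_carrier [simp]:
  "A \<in> carrier_mat n n \<Longrightarrow> B \<in> carrier_mat n n \<Longrightarrow> commutator A B \<in> carrier_mat n n"
  unfolding commutator_def by (simp add: mult_carrier_mat[of _ n n _ n] minus_carrier_mat[of _ n n])

lemma commutator_dim [simp]:
  "dim_row (commutator A B) = dim_row B" "dim_col (commutator A B) = dim_col A"
  unfolding commutator_def by simp_all

text \<open>Both \<open>T Z\<close> and \<open>Z T\<close> move the entries of \<open>T\<close> by one position, to the left and downwards, and along a
  diagonal these give the same entry. So the commutator vanishes except in row \<open>0\<close>, where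
  \<open>Z T\<close> is zero, and in column \<open>n - 1\<close>, where \<open>T Z\<close> is zero: one outer product for that row and one
  for that column.\<close>

lemma toeplitz_commutator_shift:
  assumes T: "T \<in> carrier_mat n n" and "toeplitz T"
  shows "outer_sum 2 (commutator T (shift_mat n))"
proof -
  let ?C = "commutator T (shift_mat n)"
  \<comment> \<open>The corner entry \<open>(0, n - 1)\<close> belongs to the row, so the column part starts at row \<open>1\<close>.\<close>
  let ?f = "\<lambda>(t :: nat) i. if t = 0 then (if i = 0 then 1 else 0) else (if i = 0 then 0 else ?C $$ (i, n - 1))"
  let ?g = "\<lambda>(t :: nat) j. if t = 0 then ?C $$ (0, j) else (if Suc j = n then 1 else 0)"
  have C: "?C $$ (i, j) = (if Suc j < n then T $$ (i, Suc j) else 0) - (if i = 0 then 0 else T $$ (i - 1, j))"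
    if "i < n" "j < n" for i j
    using that T
    by (simp add: commutator_def shift_mat_mult_left[of _ n n] shift_mat_mult_right[of _ n n] carrier_matD[of _ n n]
        carrier_matD[OF shift_mat_carrier] del: index_mult_mat(1))
  have inner: "?C $$ (i, j) = 0" if "i < n" "0 < i" "Suc j < n" for i j
  proof -
    have "T $$ (i, Suc j) = T $$ (i - 1, j)"
      if "i < dim_row T" "Suc j < dim_col T" "i - 1 < dim_row T" "j < dim_col T" "i + j = (i - 1) + Suc j"
      using \<open>toeplitz T\<close> that unfolding toeplitz_def by blast
    then have "T $$ (i, Suc j) = T $$ (i - 1, j)"
      using \<open>i < n\<close> \<open>0 < i\<close> \<open>Suc j < n\<close> T by simp
    then show ?thesis using that by (simp add: C)
  qed
  have "?C $$ (i, j) = (\<Sum>t<2::nat. ?f t i * ?g t j)" if "i < n" "j < n" for i j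
  proof -
    have sum2: "(\<Sum>t<2::nat. h t) = h 0 + h 1" for h :: "nat \<Rightarrow> complex"
      by (simp add: numeral_2_eq_2)
    show ?thesis
    proof (cases "Suc j = n")
      case True
      then have "n - 1 = j" by simp
      then show ?thesis using True unfolding sum2 by simp
    next
      case False
      then show ?thesis using that inner[of i j] unfolding sum2 by simp
    qed
  qed
  then have "\<forall>i<dim_row ?C. \<forall>j<dim_col ?C. ?C $$ (i, j) = (\<Sum>t<2. ?f t i * ?g t j)"
    using T by (simp only: commutator_dim carrier_matD[OF T] carrier_matD[OF shift_mat_carrier]) blast
  then show ?thesis
    unfolding outer_sum_def by (intro exI)
qed

lemma poly_mat_carrier [simp]: "A \<in> carrier_mat n n \<Longrightarrow> poly_mat p A \<in> carrier_mat n n"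
  by (simp add: poly_mat_def)

lemma pow_mat_Suc_left:
  assumes "A \<in> carrier_mat n n"
  shows "A ^\<^sub>m Suc k = A * A ^\<^sub>m k"
proof (induction k)
  case (Suc k)
  then show ?case using assms by (simp add: assoc_mult_mat[of _ n n _ n _ n])
qed (use assms in simp)

lemma poly_mat_index:
  assumes "A \<in> carrier_mat n n" "i < n" "j < n" "degree p \<le> N"
  shows "poly_mat p A $$ (i, j) = (\<Sum>k\<le>N. coeff p k * (A ^\<^sub>m k) $$ (i, j))"
proof -
  have "(\<Sum>k\<le>degree p. coeff p k * (A ^\<^sub>m k) $$ (i, j)) = (\<Sum>k\<le>N. coeff p k * (A ^\<^sub>m k) $$ (i, j))"
    using assms(4) by (intro sum.mono_neutral_left) (auto simp: coeff_eq_0)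
  then show ?thesis using assms(1-3) by (simp add: poly_mat_def)
qed

lemma poly_mat_pCons:
  assumes A: "A \<in> carrier_mat n n"
  shows "poly_mat (pCons c p) A = c \<cdot>\<^sub>m 1\<^sub>m n + A * poly_mat p A"
proof (rule eq_matI)
  fix i j assume "i < dim_row (c \<cdot>\<^sub>m 1\<^sub>m n + A * poly_mat p A)" "j < dim_col (c \<cdot>\<^sub>m 1\<^sub>m n + A * poly_mat p A)"
  with A have ij: "i < n" "j < n" by (simp_all add: poly_mat_def)
  have "poly_mat (pCons c p) A $$ (i, j) =
      (\<Sum>k\<le>Suc (degree p). coeff (pCons c p) k * (A ^\<^sub>m k) $$ (i, j))"
    by (intro poly_mat_index[OF A ij]) (simp add: degree_pCons_le)
  also have "\<dots> = c * (1\<^sub>m n) $$ (i, j) + (\<Sum>k\<le>degree p. coeff p k * (A * A ^\<^sub>m k) $$ (i, j))"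
    using A unfolding sum.atMost_Suc_shift by (simp del: pow_mat.simps(2) index_mult_mat(1) add: pow_mat_Suc_left[OF A])
  also have "(\<Sum>k\<le>degree p. coeff p k * (A * A ^\<^sub>m k) $$ (i, j)) =
      (\<Sum>k\<le>degree p. \<Sum>l<n. A $$ (i, l) * (coeff p k * (A ^\<^sub>m k) $$ (l, j)))"
    using A ij by (simp add: scalar_prod_def sum_distrib_left atLeast0LessThan mult.left_commute)
  also have "\<dots> = (\<Sum>l<n. A $$ (i, l) * poly_mat p A $$ (l, j))"
    using A ij by (subst sum.swap) (simp add: poly_mat_def sum_distrib_left)
  also have "\<dots> = (A * poly_mat p A) $$ (i, j)"
    using A ij by (simp add: scalar_prod_def atLeast0LessThan poly_mat_def)
  finally show "poly_mat (pCons c p) A $$ (i, j) = (c \<cdot>\<^sub>m 1\<^sub>m n + A * poly_mat p A) $$ (i, j)"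
    using A ij by (simp del: index_mult_mat(1) add: poly_mat_def)
qed (use A in \<open>simp_all add: poly_mat_def\<close>)

text \<open>The commutator with \<open>Z\<close> is a derivation and kills scalar matrices; this is its effect on one Horner
  step.\<close>

lemma commutator_Horner:
  fixes A :: "'a :: comm_ring_1 mat"
  assumes c: "A \<in> carrier_mat n n" "X \<in> carrier_mat n n" "Z \<in> carrier_mat n n"
  shows "commutator (c \<cdot>\<^sub>m 1\<^sub>m n + A * X) Z = A * commutator X Z + commutator A Z * X"
proof -
  note [simp] = minus_carrier_mat[of _ n n] mult_carrier_mat[of _ n n _ n]
    assoc_mult_mat[of _ n n _ n _ n] mult_add_distrib_mat[of _ n n _ n]
    add_mult_distrib_mat[of _ n n _ _ n] mult_minus_distrib_mat[of _ n n _ n]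
    minus_mult_distrib_mat[of _ n n _ _ n] mult_smult_distrib[of _ n n _ n] mult_smult_assoc_mat[of _ n n _ n]
  show ?thesis
    unfolding commutator_def using c by (intro eq_matI) (simp_all del: index_mult_mat(1))
qed

text \<open>This is where the maximum of the degrees arises, rather than their sum. A Horner step
  multiplies the two commutators from the left by the same matrix \<open>T\<close>, and the terms that
  it adds for \<open>p = a + x p'\<close> and \<open>q = b + x q'\<close>, namely \<open>[T, Z] p'(T)\<close> and \<open>[T, Z] q'(T) R\<close>, have the left factor \<open>[T, Z]\<close> in common. Treating the
  two polynomials together thus costs \<open>k\<close> outer products per degree, not \<open>2 k\<close>.\<close>

lemma commutator_poly_pair:
  assumes T: "T \<in> carrier_mat n n" and Z: "Z \<in> carrier_mat n n" and R: "R \<in> carrier_mat n n"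
    and k: "outer_sum k (commutator T Z)"
    and "degree p \<le> s" "degree q \<le> s"
  shows "outer_sum (k * s) (commutator (poly_mat p T) Z + commutator (poly_mat q T) Z * R)"
  using assms(5,6)
proof (induction s arbitrary: p q)
  case 0
  have const: "commutator (poly_mat u T) Z = 0\<^sub>m n n" if "degree u \<le> 0" for u
  proof -
    have "u = pCons (coeff u 0) 0" using that by (cases u) (auto split: if_splits)
    then have u: "poly_mat u T = coeff u 0 \<cdot>\<^sub>m 1\<^sub>m n + T * poly_mat 0 T"
      using poly_mat_pCons[OF T] by metis
    have "poly_mat 0 T = 0\<^sub>m n n" using T by (auto simp: poly_mat_def)
    moreover have "commutator (0\<^sub>m n n) Z = 0\<^sub>m n n" using Z by (auto simp: commutator_def)
    ultimately show ?thesis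
      using T Z commutator_Horner[OF T zero_carrier_mat Z, of "coeff u 0"] commutator_carrier[OF T Z]
      unfolding u by (simp add: right_mult_zero_mat[of _ n n])
  qed
  show ?case using 0 R by (simp add: const outer_sum_def)
next
  case (Suc s)
  obtain a p' where p: "p = pCons a p'" by (cases p)
  obtain b q' where q: "q = pCons b q'" by (cases q)
  have deg: "degree p' \<le> s" "degree q' \<le> s"
    using Suc.prems unfolding p q by (simp_all add: degree_pCons_eq_if split: if_splits)
  define P Q where "P = poly_mat p' T" and "Q = poly_mat q' T"
  have c: "P \<in> carrier_mat n n" "Q \<in> carrier_mat n n" using T by (simp_all add: P_def Q_def)
  note [simp] = minus_carrier_mat[of _ n n] mult_carrier_mat[of _ n n _ n]
    assoc_mult_mat[of _ n n _ n _ n] mult_add_distrib_mat[of _ n n _ n]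
    add_mult_distrib_mat[of _ n n _ _ n]
  have "commutator (poly_mat p T) Z + commutator (poly_mat q T) Z * R =
      (T * commutator P Z + commutator T Z * P) + (T * commutator Q Z + commutator T Z * Q) * R"
    using T Z c by (simp add: p q poly_mat_pCons[OF T] commutator_Horner P_def Q_def)
  also have "\<dots> = T * (commutator P Z + commutator Q Z * R) + commutator T Z * (P + Q * R)"
    using T Z R c by (intro eq_matI) (simp_all del: index_mult_mat(1))
  also have "outer_sum (k * s + k) \<dots>"
    using T Z R c k Suc.IH[OF deg]
    by (intro outer_sum_add[of _ n n] outer_sum_mult_left[of _ n n _ n] outer_sum_mult_right[of _ n n _ n])
      (simp_all add: P_def Q_def)
  finally show ?case by (simp only: mult_Suc_right add.commute)
qed

text \<open>The quotient rule for the derivation \<open>[_, Z]\<close>. The numerator has the form bounded in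
  \<open>commutator_poly_pair\<close>.\<close>

lemma commutator_quotient:
  fixes P :: "'a :: comm_ring_1 mat"
  assumes c: "P \<in> carrier_mat n n" "Q \<in> carrier_mat n n" "Q' \<in> carrier_mat n n" "Z \<in> carrier_mat n n"
    and inv: "Q' * Q = 1\<^sub>m n" "Q * Q' = 1\<^sub>m n"
  shows "commutator (Q' * P) Z = Q' * (commutator P Z + commutator Q Z * (- (Q' * P)))"
proof -
  note [simp] = minus_carrier_mat[of _ n n] mult_carrier_mat[of _ n n _ n]
    assoc_mult_mat[of _ n n _ n _ n] mult_add_distrib_mat[of _ n n _ n]
    add_mult_distrib_mat[of _ n n _ _ n] mult_minus_distrib_mat[of _ n n _ n]
    minus_mult_distrib_mat[of _ n n _ _ n]
  note [simp] = mult_inverse_cancel[OF c(3,2) _ inv(1), where m = n] mult_inverse_cancel[OF c(2,3) _ inv(2), where m = n]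
  show ?thesis
    unfolding commutator_def using c by (intro eq_matI) (simp_all del: index_mult_mat(1))
qed

section \<open>Displacement rank of a rational function\<close>

lemma displacement_carrier [simp]:
  assumes "A \<in> carrier_mat n n"
  shows "displacement A \<in> carrier_mat n n"
proof -
  have "dim_row A = n" using assms by simp
  then show ?thesis
    unfolding displacement_def
    by (intro minus_carrier_mat mult_carrier_mat[of _ n n] mat_adjoint_carrier) (simp_all add: assms)
qed

text \<open>Writing the first term of \<open>A - Z A Z\<^sup>*\<close> as \<open>A (Z Z\<^sup>* + e\<^sub>1 e\<^sub>1\<^sup>*)\<close> turns the displacement into a
  commutator plus one outer product.\<close>

lemma displacement_conv_commutator:
  assumes A: "A \<in> carrier_mat n n"
  shows "displacement A = A * unit_projector n + commutator A (shift_mat n) * mat_adjoint (shift_mat n)"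
proof -
  define Z where "Z = shift_mat n"
  have c: "Z \<in> carrier_mat n n" "mat_adjoint Z \<in> carrier_mat n n" "unit_projector n \<in> carrier_mat n n"
    by (simp_all add: Z_def unit_projector_def)
  note [simp] = minus_carrier_mat[of _ n n] mult_carrier_mat[of _ n n _ n] assoc_mult_mat[of _ n n _ n _ n]
    mult_minus_distrib_mat[of _ n n _ n] minus_mult_distrib_mat[of _ n n _ _ n]
  have "Z * mat_adjoint Z = 1\<^sub>m n - unit_projector n"
    unfolding Z_def by (rule shift_mat_adjoint)
  then have "A * (Z * mat_adjoint Z) = A - A * unit_projector n"
    using A c by (simp add: right_mult_one_mat[of _ n n])
  moreover have "displacement A = A - Z * (A * mat_adjoint Z)"
    using A c by (simp add: displacement_def Z_def)
  ultimately show ?thesis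
    unfolding commutator_def Z_def[symmetric]
    using A c by (intro eq_matI) (simp_all del: index_mult_mat(1))
qed

lemma displacement_rank_rational:
  assumes T: "T \<in> carrier_mat n n" and "toeplitz T"
    and deg: "degree p \<le> s" "degree q \<le> s"
    and Q': "Q' \<in> carrier_mat n n" "Q' * poly_mat q T = 1\<^sub>m n" "poly_mat q T * Q' = 1\<^sub>m n"
  shows "displacement_rank (Q' * poly_mat p T) \<le> 2 * s + 1"
proof -
  define P Q Z r where "P = poly_mat p T" and "Q = poly_mat q T" and "Z = shift_mat n" and "r = Q' * P"
  have c: "P \<in> carrier_mat n n" "Q \<in> carrier_mat n n" "Z \<in> carrier_mat n n" "r \<in> carrier_mat n n"
    "mat_adjoint Z \<in> carrier_mat n n" "unit_projector n \<in> carrier_mat n n"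
    using T Q' by (simp_all add: P_def Q_def Z_def r_def unit_projector_def mult_carrier_mat[of _ n n])
  have "outer_sum (2 * s) (commutator P Z + commutator Q Z * (- r))"
    unfolding P_def Q_def Z_def
    using T c toeplitz_commutator_shift[OF T \<open>toeplitz T\<close>] deg
    by (intro commutator_poly_pair[of _ n]) simp_all
  then have "outer_sum (2 * s) (Q' * (commutator P Z + commutator Q Z * (- r)))"
    using c Q' by (intro outer_sum_mult_left[of _ n n _ n]) (simp_all add: mult_carrier_mat[of _ n n])
  then have comm: "outer_sum (2 * s) (commutator r Z)"
    using commutator_quotient[of P n Q Q' Z] c Q' by (simp add: r_def Q_def)
  have proj: "outer_sum 1 (unit_projector n)"
    unfolding outer_sum_def
    by (intro exI[of _ "\<lambda>_ i. if i = 0 then 1 else 0"]) (simp add: unit_projector_def)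
  have "outer_sum (1 + 2 * s) (displacement r)"
    unfolding displacement_conv_commutator[OF c(4)] Z_def[symmetric]
    using c comm proj
    by (intro outer_sum_add[of _ n n] outer_sum_mult_left[of _ n n _ n] outer_sum_mult_right[of _ n n _ n])
      (simp_all add: mult_carrier_mat[of _ n n])
  moreover have "displacement r \<in> carrier_mat n n" "dim_row r = n"
    using c by simp_all
  ultimately show ?thesis
    using outer_sum_rank_le[of "displacement r" n n] unfolding displacement_rank_def r_def P_def by simp
qed

section \<open>The generator\<close>

text \<open>Juxtaposing generators adds the matrices that they generate.\<close>

lemma mat_of_cols_append_mult_adjoint:
  fixes xs ys :: "complex vec list"
  assumes "length xs = length xs'" "length ys = length ys'"
  shows "mat_of_cols n (xs @ ys) * mat_adjoint (mat_of_cols n (xs' @ ys')) =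
    mat_of_cols n xs * mat_adjoint (mat_of_cols n xs') + mat_of_cols n ys * mat_adjoint (mat_of_cols n ys')"
proof (rule eq_matI, goal_cases)
  case (1 i j)
  then have ij: "i < n" "j < n" by simp_all
  have entry: "(mat_of_cols n us * mat_adjoint (mat_of_cols n vs)) $$ (i, j) =
      (\<Sum>t<length us. us ! t $ i * conjugate (vs ! t $ j))" if "length us = length vs" for us vs :: "complex vec list"
    using ij that by (auto simp: scalar_prod_def mat_adjoint_index mat_of_cols_def atLeast0LessThan intro!: sum.cong)
  show ?case
    using assms ij by (simp add: entry sum_lessThan_add nth_append del: index_mult_mat(1))
qed simp_all

text \<open>Here \<open>D = Z - I\<close>, so that \<open>Z Z\<^sup>* = I - e\<^sub>1 e\<^sub>1\<^sup>*\<close> takes the form \<open>D + e\<^sub>1 e\<^sub>1\<^sup>* = - Z D\<^sup>*\<close>, and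
  \<open>\<nabla>(A) = - (D A + Z A D\<^sup>*)\<close>. Put \<open>r = Q\<^sup>-\<^sup>1 P\<close>, \<open>W = D\<^sup>-\<^sup>* r D\<^sup>*\<close> and
  \<open>M = D Q\<^sup>-\<^sup>1 D\<^sup>-\<^sup>1 Z P D\<^sup>*\<close>. Substituting the formula for \<open>\<nabla>\<close>, the first term on the right becomes
  \<open>D W + M\<close> and the second \<open>- (D r + M)\<close>. In the sum \<open>M\<close> cancels, and the remaining
  \<open>(D + e\<^sub>1 e\<^sub>1\<^sup>*) W = - Z D\<^sup>* W = - Z r D\<^sup>*\<close> together with \<open>- D r\<close> is \<open>\<nabla>(r)\<close>.\<close>

lemma displacement_quotient:
  assumes c: "P \<in> carrier_mat n n" "Q \<in> carrier_mat n n" "Q' \<in> carrier_mat n n" "D' \<in> carrier_mat n n"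
    and Q: "Q' * Q = 1\<^sub>m n" "Q * Q' = 1\<^sub>m n"
    and D: "D = shift_mat n - 1\<^sub>m n" "D' * D = 1\<^sub>m n" "D * D' = 1\<^sub>m n"
  shows "displacement (Q' * P) =
    - (D * Q' * D' * displacement Q * (mat_adjoint D' * Q' * P * mat_adjoint D)) +
    (D * Q' * D' * displacement P + unit_projector n * (mat_adjoint D' * Q' * P * mat_adjoint D))"
proof -
  define Z S Ds E where "Z = shift_mat n" and "S = mat_adjoint D'" and "Ds = mat_adjoint D"
    and "E = unit_projector n"
  have d: "Z \<in> carrier_mat n n" "S \<in> carrier_mat n n" "Ds \<in> carrier_mat n n" "E \<in> carrier_mat n n"
    "D \<in> carrier_mat n n"
    using c D(1) by (simp_all add: Z_def S_def Ds_def E_def unit_projector_def minus_carrier_mat[of _ n n])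
  note c = c d
  have DsS: "Ds * S = 1\<^sub>m n"
    unfolding Ds_def S_def using c D(2) by (simp add: mat_adjoint_mult[of _ n n _ n, symmetric])
  have Z: "Z = D + 1\<^sub>m n"
    unfolding D(1) Z_def using shift_mat_carrier[of n] by (intro eq_matI) (simp_all add: carrier_matD[of _ n n])
  have Zs: "mat_adjoint Z = Ds + 1\<^sub>m n"
    unfolding Ds_def D(1) Z_def[symmetric] using c by (subst mat_adjoint_minus[of _ n n]) (auto intro!: eq_matI)
  note [simp] = minus_carrier_mat[of _ n n] mult_carrier_mat[of _ n n _ n] add_carrier_mat[of _ n n]
    uminus_carrier_mat[of _ n n] assoc_mult_mat[of _ n n _ n _ n]
    mult_add_distrib_mat[of _ n n _ n] add_mult_distrib_mat[of _ n n _ _ n]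
    mult_minus_distrib_mat[of _ n n _ n] minus_mult_distrib_mat[of _ n n _ _ n]
    left_mult_one_mat[of _ n n] right_mult_one_mat[of _ n n]
  note cancel = mult_inverse_cancel[OF c(3,2) _ Q(1), where m = n] mult_inverse_cancel[OF c(2,3) _ Q(2), where m = n]
    mult_inverse_cancel[OF c(4,9) _ D(2), where m = n] mult_inverse_cancel[OF c(9,4) _ D(3), where m = n]
    mult_inverse_cancel[OF c(7,6) _ DsS, where m = n]
  have disp: "displacement A = - (D * A + Z * (A * Ds))" if "A \<in> carrier_mat n n" for A
  proof -
    have "displacement A = A - Z * (A * (Ds + 1\<^sub>m n))"
      using that c by (simp add: displacement_def Z_def[symmetric] Zs)
    also have "\<dots> = A - (Z * (A * Ds) + (D * A + A))"
      using that c by (simp add: Z)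
    also have "\<dots> = - (D * A + Z * (A * Ds))"
      using that c by (intro eq_matI) (simp_all del: index_mult_mat(1))
    finally show ?thesis .
  qed
  have E: "D + E = - (Z * Ds)"
  proof -
    have "Z * (Ds + 1\<^sub>m n) = 1\<^sub>m n - E"
      unfolding Zs[symmetric] using shift_mat_adjoint by (simp add: Z_def E_def)
    then have "Z * Ds + Z = 1\<^sub>m n - E" using c by simp
    then have eq: "(Z * Ds + Z) $$ (i, j) = (1\<^sub>m n - E) $$ (i, j)" for i j by simp
    show ?thesis
    proof (rule eq_matI, goal_cases)
      case (1 i j)
      with c have "i < n" "j < n" by simp_all
      with c eq[of i j] show ?case
        unfolding D(1) Z_def[symmetric]
        by (simp add: carrier_matD[of _ n n] algebra_simps del: index_mult_mat(1))
    qed (use c in simp_all)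
  qed
  define W where "W = S * (Q' * (P * Ds))"
  have cW: "W \<in> carrier_mat n n" unfolding W_def using c by simp
  define M where "M = D * (Q' * (D' * (Z * (P * Ds))))"
  have cM: "M \<in> carrier_mat n n" unfolding M_def using c by simp
  have p: "D * Q' * D' * displacement P = - (D * (Q' * P) + M)"
    using c by (simp add: disp cancel M_def uminus_mult_right_mat)
  have q: "D * Q' * D' * displacement Q * W = - (D * W + M)"
    using c by (simp add: disp cancel M_def W_def)
  have "(D + E) * W = - (Z * (Q' * (P * Ds)))"
    unfolding E W_def using c by (simp add: cancel)
  then have e: "D * W + E * W = - (Z * (Q' * (P * Ds)))" using c cW by simp
  have combine: "- (V + U) = - (- (X + M)) + (- (V + M) + Y)"
    if "X + Y = - U" "X \<in> carrier_mat n n" "Y \<in> carrier_mat n n" "U \<in> carrier_mat n n" "V \<in> carrier_mat n n"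
    for X Y U V :: "complex mat"
  proof (rule eq_matI, goal_cases)
    case (1 i j)
    with cM have ij: "i < n" "j < n" using that by simp_all
    have "(X + Y) $$ (i, j) = (- U) $$ (i, j)" by (simp only: that(1))
    then have "Y $$ (i, j) = - U $$ (i, j) - X $$ (i, j)"
      using that(2-4) ij by (simp add: eq_diff_eq add.commute)
    then show ?case using that(2-5) cM ij by simp
  qed (use that cM in simp_all)
  have "displacement (Q' * P) = - (D * (Q' * P) + Z * (Q' * (P * Ds)))"
    using c by (simp add: disp)
  also have "\<dots> = - (- (D * W + M)) + (- (D * (Q' * P) + M) + E * W)"
    by (rule combine[OF e]) (use c cW in simp_all)
  finally show ?thesis
    unfolding S_def[symmetric] Ds_def[symmetric] E_def[symmetric] p[symmetric] q[symmetric]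
    using c by (simp add: W_def)
qed

lemma mult_mat_of_cols_single:
  assumes "A \<in> carrier_mat m n" "v \<in> carrier_vec n"
  shows "mat_of_cols m [A *\<^sub>v v] = A * mat_of_cols n [v]"
  using assms by (intro eq_matI) (auto simp: mat_of_cols_def mult_mat_vec_def scalar_prod_def)

text \<open>The contribution of the last column of the generator pair.\<close>

lemma unit_vec_outer:
  assumes "W \<in> carrier_mat n n"
  shows "mat_of_cols n [unit_vec n 0] * mat_adjoint (mat_of_cols n [W *\<^sub>v unit_vec n 0]) =
    unit_projector n * mat_adjoint W"
proof -
  define E :: "complex mat" where "E = mat_of_cols n [unit_vec n 0]"
  have E: "E \<in> carrier_mat n 1" unfolding E_def by auto
  have EE: "E * mat_adjoint E = unit_projector n"
    using E by (intro eq_matI)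
      (auto simp: unit_projector_def E_def scalar_prod_def mat_adjoint_index mat_of_cols_def)
  have "E * mat_adjoint (mat_of_cols n [W *\<^sub>v unit_vec n 0]) = E * (mat_adjoint E * mat_adjoint W)"
    using assms E by (simp add: mult_mat_of_cols_single[of _ _ n] mat_adjoint_mult[of W n n E 1] flip: E_def)
  also have "\<dots> = unit_projector n * mat_adjoint W"
    unfolding EE[symmetric] using assms E
    by (simp only: assoc_mult_mat[of E n 1 "mat_adjoint E" n "mat_adjoint W" n] mat_adjoint_carrier)
  finally show ?thesis unfolding E_def .
qed

lemma mult_outer_product:
  fixes M :: "complex mat"
  assumes "M \<in> carrier_mat n n" "G \<in> carrier_mat n k" "B \<in> carrier_mat n k" "W \<in> carrier_mat n n"
  shows "M * G * mat_adjoint (W * B) = M * (G * mat_adjoint B) * mat_adjoint W"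
proof -
  have "M * G * mat_adjoint (W * B) = M * G * (mat_adjoint B * mat_adjoint W)"
    using assms by (simp add: mat_adjoint_mult[of W n n B k])
  also have "\<dots> = M * G * mat_adjoint B * mat_adjoint W"
    by (rule assoc_mult_mat[symmetric, of _ n k _ n _ n]) (use assms in simp_all)
  also have "M * G * mat_adjoint B = M * (G * mat_adjoint B)"
    by (rule assoc_mult_mat[of _ n n _ k _ n]) (use assms in simp_all)
  finally show ?thesis .
qed

theorem theorem3p7:
  fixes n s\<^sub>p s\<^sub>q :: nat
    and T G\<^sub>p B\<^sub>p G\<^sub>q B\<^sub>q :: "complex mat"
    and p q :: "complex poly"
  assumes "T \<in> carrier_mat n n" and "toeplitz T"
    and "degree p \<le> s\<^sub>p" and "degree q \<le> s\<^sub>q"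
    and "invertible_mat (poly_mat q T)"
    and "is_generator (poly_mat p T) G\<^sub>p B\<^sub>p"
    and "is_generator (poly_mat q T) G\<^sub>q B\<^sub>q"
  shows
    "let P = poly_mat p T;
         Q' = mat_inv (poly_mat q T);
         r = Q' * P;
         D = shift_mat n - 1\<^sub>m n;
         D' = mat_inv D;
         e\<^sub>1 = unit_vec n 0;
         G = mat_of_cols n
               (cols (- (D * Q' * D' * G\<^sub>q)) @ cols (D * Q' * D' * G\<^sub>p) @ [e\<^sub>1]);
         B = mat_of_cols n
               (cols (D * mat_adjoint P * mat_adjoint Q' * D' * B\<^sub>q) @ cols B\<^sub>p @
                [(D * mat_adjoint P * mat_adjoint Q' * D') *\<^sub>v e\<^sub>1])
     in displacement_rank r \<le> 2 * max s\<^sub>p s\<^sub>q + 1 \<and> is_generator r G B"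
proof -
  define P Q Q' D D' where "P = poly_mat p T" and "Q = poly_mat q T" and "Q' = mat_inv (poly_mat q T)"
    and "D = shift_mat n - 1\<^sub>m n" and "D' = mat_inv (shift_mat n - 1\<^sub>m n)"
  \<comment> \<open>\<open>M\<close> multiplies \<open>G\<^sub>q\<close> and \<open>G\<^sub>p\<close> in \<open>G\<close>; \<open>W\<close> multiplies \<open>B\<^sub>q\<close> and \<open>e\<^sub>1\<close> in \<open>B\<close>.\<close>
  define M W where "M = D * Q' * D'" and "W = D * mat_adjoint P * mat_adjoint Q' * D'"
  have T: "T \<in> carrier_mat n n" by fact
  have P: "P \<in> carrier_mat n n" and Q: "Q \<in> carrier_mat n n" and D: "D \<in> carrier_mat n n"
    using T by (simp_all add: P_def Q_def D_def minus_carrier_mat[of _ n n])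
  have "Q \<in> Units (ring_mat TYPE(complex) n ())"
    using invertible_mat_Units[OF Q] assms(5) unfolding Q_def by blast
  note Q' = mat_inv_inverse[OF Q this, unfolded Q_def, folded Q'_def Q_def]
  have "D \<in> Units (ring_mat TYPE(complex) n ())"
    unfolding D_def by (rule shift_minus_one_Units)
  note D' = mat_inv_inverse[OF D this, unfolded D_def, folded D'_def D_def]
  have M: "M \<in> carrier_mat n n" and W: "W \<in> carrier_mat n n"
    unfolding M_def W_def using P D Q'(1) D'(1)
    by (simp_all add: mult_carrier_mat[of _ n n])
  have W_adjoint: "mat_adjoint W = mat_adjoint D' * Q' * P * mat_adjoint D"
  proof -
    note [simp] = mult_carrier_mat[of _ n n _ n] assoc_mult_mat[of _ n n _ n _ n]
    show ?thesis
      unfolding W_def using P D Q'(1) D'(1) by (simp add: mat_adjoint_mult[of _ n n _ n])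
  qed

  have dim: "dim_row (poly_mat p T) = n" "dim_row (poly_mat q T) = n"
    using T by (simp_all add: poly_mat_def)
  obtain k where Gp: "G\<^sub>p \<in> carrier_mat n k" and Bp: "B\<^sub>p \<in> carrier_mat n k"
    and p: "displacement P = G\<^sub>p * mat_adjoint B\<^sub>p"
    using assms(6) unfolding is_generator_def dim P_def by blast
  obtain l where Gq: "G\<^sub>q \<in> carrier_mat n l" and Bq: "B\<^sub>q \<in> carrier_mat n l"
    and q: "displacement Q = G\<^sub>q * mat_adjoint B\<^sub>q"
    using assms(7) unfolding is_generator_def dim Q_def by blast
  define G B where
    "G = mat_of_cols n (cols (- (M * G\<^sub>q)) @ cols (M * G\<^sub>p) @ [unit_vec n 0])" and
    "B = mat_of_cols n (cols (W * B\<^sub>q) @ cols B\<^sub>p @ [W *\<^sub>v unit_vec n 0])"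
  have mat_of_cols_cols_n: "mat_of_cols n (cols A) = A" if "A \<in> carrier_mat n m" for A :: "complex mat" and m
    using that mat_of_cols_cols[of A] by simp
  have cMG: "M * G\<^sub>q \<in> carrier_mat n l" "- (M * G\<^sub>q) \<in> carrier_mat n l"
    "M * G\<^sub>p \<in> carrier_mat n k" "W * B\<^sub>q \<in> carrier_mat n l"
    using M W Gq Gp Bq by (simp_all add: mult_carrier_mat[of _ n n])
  have "G * mat_adjoint B =
      - (M * G\<^sub>q) * mat_adjoint (W * B\<^sub>q) +
      (M * G\<^sub>p * mat_adjoint B\<^sub>p + mat_of_cols n [unit_vec n 0] * mat_adjoint (mat_of_cols n [W *\<^sub>v unit_vec n 0]))"
    unfolding G_def B_def
    by (simp add: mat_of_cols_append_mult_adjoint carrier_matD(2)[OF Gp] carrier_matD(2)[OF Bp]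
        carrier_matD(2)[OF Gq] carrier_matD(2)[OF Bq] mat_of_cols_cols_n[OF Bp] mat_of_cols_cols_n[OF cMG(2)]
        mat_of_cols_cols_n[OF cMG(3)] mat_of_cols_cols_n[OF cMG(4)] del: uminus_mult_left_mat)
  also have "- (M * G\<^sub>q) * mat_adjoint (W * B\<^sub>q) = - (M * displacement Q * mat_adjoint W)"
    unfolding q mult_outer_product[OF M Gq Bq W, symmetric]
    by (rule uminus_mult_left_mat) (simp add: carrier_matD(2)[OF Gq] carrier_matD(2)[OF Bq])
  also have "M * G\<^sub>p * mat_adjoint B\<^sub>p = M * displacement P"
    unfolding p by (rule assoc_mult_mat[OF M Gp mat_adjoint_carrier[OF Bp]])
  also have "mat_of_cols n [unit_vec n 0] * mat_adjoint (mat_of_cols n [W *\<^sub>v unit_vec n 0]) =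
      unit_projector n * mat_adjoint W"
    by (rule unit_vec_outer[OF W])
  also have "- (M * displacement Q * mat_adjoint W) + (M * displacement P + unit_projector n * mat_adjoint W) =
      displacement (Q' * P)"
    unfolding M_def W_adjoint
    by (rule displacement_quotient[symmetric, OF P Q Q'(1) D'(1) Q'(2,3) D_def D'(2,3)])
  finally have "displacement (Q' * P) = G * mat_adjoint B" by (rule sym)
  moreover have "dim_row G = n" "dim_row B = n" "dim_row (Q' * P) = n"
    using Q'(1) by (simp_all add: G_def B_def)
  moreover have "dim_col G = l + k + 1" "dim_col B = l + k + 1"
    by (simp_all only: G_def B_def mat_of_cols_carrier length_append cols_length list.size
        carrier_matD(2)[OF cMG(2)] carrier_matD(2)[OF cMG(3)] carrier_matD(2)[OF cMG(4)]
        carrier_matD(2)[OF Bp] add.assoc plus_nat.add_0 One_nat_def add_Suc_right add_0_right)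
  ultimately have gen: "is_generator (Q' * P) G B"
    unfolding is_generator_def by (intro exI[of _ "l + k + 1"] conjI carrier_matI) simp_all
  have rank: "displacement_rank (Q' * P) \<le> 2 * max s\<^sub>p s\<^sub>q + 1"
    unfolding P_def
    by (rule displacement_rank_rational[OF T \<open>toeplitz T\<close> _ _ Q'[unfolded Q_def]])
      (simp_all add: assms(3,4) le_max_iff_disj)
  from conjI[OF rank gen] show ?thesis
    unfolding Let_def G_def B_def M_def W_def P_def Q'_def D_def D'_def .
qed

end
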